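(* For every odd $n\ge 3$, regular $n$-gons can be characterized by two center functions, provided that they are convex: there are two $n$-gon center functions $f_1,f_2$ such that a convex $n$-gon $(V_1,\ldots,V_n)$ is regular if and only if $f_l(V_1,\ldots,V_n)=f_l(V_2,\ldots,V_n,V_1)=\ldots=f_l(V_n,V_1,\ldots,V_{n-1})$ for $l=1,2$. For every even $n\ge 4$, regular $n$-gons cannot be characterized by two center functions in this way.
   Context: An $n$-gon is identified with a tuple $(V_1,\ldots,V_n)$ of points of $\mathbb R^2$ (its labelled vertices), the edges being the segments $V_iV_{i+1}$ (indices mod $n$, taken in $\{1,\ldots,n\}$). It is convex if $V_i\ne V_j$ for $i\ne j$ and, for every $i$, all vertices except $V_i,V_{i+1}$ lie on the same side of the line through $V_i,V_{i+1}$. It is regular if it is equilateral and equiangular. Let $\sigma$ be the permutation of $\{1,\ldots,n\}$ given by $\sigma(i)=2+n-i\bmod n$ (so $\sigma(1)=1$). An $n$-gon center function (here with domain the convex $n$-gons) is a real-valued function $f(V_1,\ldots,V_n)$ such that, for $n$-gons in its domain: (1) $f(V_1,V_2,\ldots,V_n)=f(V_1,V_{\sigma(2)},\ldots,V_{\sigma(n)})$; (2) there is $k\in\mathbb N$ (with $0\in\mathbb N$) such that $f(tV_1,\ldots,tV_n)=t^kf(V_1,\ldots,V_n)$ for all $t\in\mathbb R_{\ge 0}$ (for which $(tV_1,\ldots,tV_n)$ is in the domain); (3) $f(T(V_1),\ldots,T(V_n))=f(V_1,\ldots,V_n)$ for every rigid motion (isometry) $T$ of the plane. In general, center functions $f_1,\ldots,f_k$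 characterize a family $\mathcal F$ of $n$-gons if: $(V_1,\ldots,V_n)\in\mathcal F$ if and only if $f_l(V_1,\ldots,V_n)=f_l(V_2,\ldots,V_n,V_1)=\ldots=f_l(V_n,V_1,\ldots,V_{n-1})$ for every $l=1,\ldots,k$. *)

theory Defs
  imports "HOL-Analysis.Analysis"
begin

text \<open>
  An \<open>n\<close>-gon \<open>(V\<^sub>1, \<dots>, V\<^sub>n)\<close> is the list of its labelled vertices, of length \<open>n\<close>.
  List positions start at 0, so \<open>V ! i\<close> is the vertex \<open>V\<^bsub>i+1\<^esub>\<close>.
\<close>

type_synonym ngon = "(real^2) list"

abbreviation next_vertex :: "ngon \<Rightarrow> nat \<Rightarrow> real^2" where
  "next_vertex V i \<equiv> V ! ((i + 1) mod length V)"

abbreviation prev_vertex :: "ngon \<Rightarrow> nat \<Rightarrow> real^2" where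
  "prev_vertex V i \<equiv> V ! ((i + length V - 1) mod length V)"

text \<open>
  The sides of a line are the two \<^emph>\<open>open\<close> half-planes it bounds; a point of the line lies
  on neither side. The sign of \<open>a\<close> is free, so \<open><\<close> covers both sides.
\<close>

definition on_same_side :: "(real^2) set \<Rightarrow> (real^2) set \<Rightarrow> bool" where
  "on_same_side L S \<longleftrightarrow>
     (\<exists>a c. a \<noteq> 0 \<and> L = {x. a \<bullet> x = c} \<and> (\<forall>x\<in>S. a \<bullet> x < c))"

definition convex_ngon :: "nat \<Rightarrow> ngon \<Rightarrow> bool" where
  "convex_ngon n V \<longleftrightarrow>
     length V = n \<and>
     (\<forall>i<n. \<forall>j<n. i \<noteq> j \<longrightarrow> V ! i \<noteq> V ! j) \<and>
     (\<forall>i<n. on_same_side (affine hull {V ! i, next_vertex V i})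
              {V ! j |j. j < n \<and> j \<noteq> i \<and> j \<noteq> (i + 1) mod n})"

text \<open>
  The unoriented angle \<open>A B C\<close> at \<open>B\<close>, in \<open>[0, \<pi>]\<close>. At a vertex of a convex polygon
  it is the interior angle.
\<close>

definition angle :: "real^2 \<Rightarrow> real^2 \<Rightarrow> real^2 \<Rightarrow> real" where
  "angle A B C = arccos (((A - B) \<bullet> (C - B)) / (norm (A - B) * norm (C - B)))"

definition equilateral :: "ngon \<Rightarrow> bool" where
  "equilateral V \<longleftrightarrow>
     (\<forall>i<length V. \<forall>j<length V.
        dist (V ! i) (next_vertex V i) = dist (V ! j) (next_vertex V j))"

definition equiangular :: "ngon \<Rightarrow> bool" where
  "equiangular V \<longleftrightarrow>
     (\<forall>i<length V. \<forall>j<length V.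
        angle (prev_vertex V i) (V ! i) (next_vertex V i) =
        angle (prev_vertex V j) (V ! j) (next_vertex V j))"

definition regular :: "ngon \<Rightarrow> bool" where
  "regular V \<longleftrightarrow> equilateral V \<and> equiangular V"

text \<open>
  \<open>(V\<^sub>1, V\<^sub>2, \<dots>, V\<^sub>n) \<mapsto> (V\<^sub>1, V\<^bsub>\<sigma>(2)\<^esub>, \<dots>, V\<^bsub>\<sigma>(n)\<^esub>) = (V\<^sub>1, V\<^sub>n, \<dots>, V\<^sub>2)\<close> for
  \<open>\<sigma>(i) \<equiv> 2 + n - i (mod n)\<close> in \<open>{1, \<dots>, n}\<close>; on positions counted from 0, \<open>\<sigma>\<close>
  becomes \<open>i \<mapsto> (n - i) mod n\<close>.
\<close>

definition reflect_labels :: "ngon \<Rightarrow> ngon" where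
  "reflect_labels V = map (\<lambda>i. V ! ((length V - i) mod length V)) [0..<length V]"

text \<open>
  A center function with domain \<open>D\<close> is modelled by a total function whose values outside
  \<open>D\<close> are irrelevant: each condition relates only polygons in \<open>D\<close>.
\<close>

definition center_function :: "ngon set \<Rightarrow> (ngon \<Rightarrow> real) \<Rightarrow> bool" where
  "center_function D f \<longleftrightarrow>
     (\<forall>V\<in>D. reflect_labels V \<in> D \<longrightarrow> f (reflect_labels V) = f V) \<and>
     (\<exists>k::nat. \<forall>V\<in>D. \<forall>t\<ge>0. map (\<lambda>v. t *\<^sub>R v) V \<in> D \<longrightarrow>
        f (map (\<lambda>v. t *\<^sub>R v) V) = t ^ k * f V) \<and>
     (\<forall>V\<in>D. \<forall>T. (\<forall>x y. dist (T x) (T y) = dist x y) \<longrightarrow> map T V \<in> D \<longrightarrow>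
        f (map T V) = f V)"

text \<open>
  \<open>rotate i V = (V\<^bsub>i+1\<^esub>, \<dots>, V\<^sub>n, V\<^sub>1, \<dots>, V\<^sub>i)\<close>.
\<close>

definition characterize ::
    "ngon set \<Rightarrow> (ngon \<Rightarrow> real) set \<Rightarrow> (ngon \<Rightarrow> bool) \<Rightarrow> bool" where
  "characterize D Fs P \<longleftrightarrow>
     (\<forall>V\<in>D. P V \<longleftrightarrow> (\<forall>f\<in>Fs. \<forall>i<length V. f (rotate i V) = f V))"

end

(* For odd n, the length of the side opposite to the first vertex and the angle at the first
   vertex characterize regularity. For even n no family of center functions does: in a convex
   n-gon inscribed in a circle whose side lengths alternate between two values, the reflection
   in the perpendicular bisector of a side maps each of its endpoints to the other and preserves
   the polygon, so every center function takes the same value at all vertices. *)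

theory Submission imports Defs begin

section \<open>Relabelling the vertices of a convex polygon\<close>

text \<open>Since vertices are distinct, excluding two indices is the same as excluding two points.
  The remaining vertices are then described through \<open>set V\<close>, which no relabelling
  changes, so a relabelling only has to be shown to carry edges to edges.\<close>

lemma convex_ngon_iff:
  "convex_ngon n V \<longleftrightarrow> length V = n \<and> distinct V \<and>
     (\<forall>i<n. on_same_side (affine hull {V ! i, V ! ((i + 1) mod n)})
              (set V - {V ! i, V ! ((i + 1) mod n)}))"
proof (cases "length V = n \<and> distinct V")
  case True
  then have len: "length V = n" and dis: "distinct V" by auto
  have "{V ! j |j. j < n \<and> j \<noteq> i \<and> j \<noteq> (i + 1) mod n} = set V - {V ! i, V ! ((i + 1) mod n)}"
    if "i < n" for i
  proof -
    have "(i + 1) mod n < n" using that by simp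
    then have "V ! j = V ! i \<longleftrightarrow> j = i" "V ! j = V ! ((i + 1) mod n) \<longleftrightarrow> j = (i + 1) mod n"
      if "j < n" for j
      using that \<open>i < n\<close> len dis nth_eq_iff_index_eq by metis+
    then show ?thesis
      unfolding set_conv_nth len by auto
  qed
  then show ?thesis
    using len dis unfolding convex_ngon_def by (simp add: nth_eq_iff_index_eq)
next
  case False
  then show ?thesis unfolding convex_ngon_def by (auto simp: distinct_conv_nth)
qed

text \<open>Edge \<open>i\<close> of the rotated polygon is edge \<open>(k + i) mod n\<close> of
  \<open>V\<close>.\<close>

lemma convex_ngon_rotate:
  assumes "convex_ngon n V"
  shows "convex_ngon n (rotate k V)"
proof -
  have len: "length V = n" and dis: "distinct V"
    and side: "\<And>i. i < n \<Longrightarrow> on_same_side (affine hull {V ! i, V ! ((i + 1) mod n)})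
              (set V - {V ! i, V ! ((i + 1) mod n)})"
    using assms unfolding convex_ngon_iff by auto
  have "on_same_side (affine hull {rotate k V ! i, rotate k V ! ((i + 1) mod n)})
              (set V - {rotate k V ! i, rotate k V ! ((i + 1) mod n)})" if "i < n" for i
  proof -
    have "rotate k V ! i = V ! ((k + i) mod n)"
      using that len by (simp add: nth_rotate)
    moreover have "rotate k V ! ((i + 1) mod n) = V ! (((k + i) mod n + 1) mod n)"
      using that len by (simp add: nth_rotate mod_simps)
    ultimately show ?thesis using side[of "(k + i) mod n"] that by simp
  qed
  then show ?thesis unfolding convex_ngon_iff using len dis by simp
qed

lemma length_reflect_labels [simp]: "length (reflect_labels V) = length V"
  by (simp add: reflect_labels_def)

lemma nth_reflect_labels:
  "i < length V \<Longrightarrow> reflect_labels V ! i = V ! ((length V - i) mod length V)"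
  by (simp add: reflect_labels_def)

lemma center_function_reflect_labels:
  assumes "center_function D f" "V \<in> D" "reflect_labels V \<in> D"
  shows "f (reflect_labels V) = f V"
  using assms unfolding center_function_def by blast

lemma center_function_isometry:
  assumes "center_function D f" "V \<in> D" "map T V \<in> D" "\<And>x y. dist (T x) (T y) = dist x y"
  shows "f (map T V) = f V"
  using assms unfolding center_function_def by blast

text \<open>The map is negation modulo \<open>n\<close>, hence its own inverse.\<close>

lemma bij_betw_reflect_index: "bij_betw (\<lambda>i. (n - i) mod n) {..<n} {..<n::nat}"
proof -
  have "(n - (n - i) mod n) mod n = i" if "i < n" for i
    using that by (cases "i = 0") simp_all
  then show ?thesis
    by (intro bij_betw_byWitness[where f' = "\<lambda>i. (n - i) mod n"]) auto
qed

lemma set_reflect_labels [simp]: "set (reflect_labels V) = set V"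
proof -
  have "set (reflect_labels V) = (!) V ` ((\<lambda>i. (length V - i) mod length V) ` {..<length V})"
    by (auto simp: reflect_labels_def)
  also have "\<dots> = (!) V ` {..<length V}"
    using bij_betw_reflect_index by (simp add: bij_betw_def)
  finally show ?thesis by (auto simp: set_conv_nth)
qed

text \<open>Edge \<open>i\<close> of the reflected labelling is edge \<open>n - 1 - i\<close> of
  \<open>V\<close> traversed backwards.\<close>

lemma convex_ngon_reflect_labels:
  assumes "convex_ngon n V"
  shows "convex_ngon n (reflect_labels V)"
proof -
  have len: "length V = n" and dis: "distinct V"
    and side: "\<And>i. i < n \<Longrightarrow> on_same_side (affine hull {V ! i, V ! ((i + 1) mod n)})
              (set V - {V ! i, V ! ((i + 1) mod n)})"
    using assms unfolding convex_ngon_iff by auto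
  have "distinct (reflect_labels V)"
    \<comment> \<open>Both labellings have the same vertex set and the same length.\<close>
    by (rule card_distinct) (simp add: distinct_card dis)
  moreover have "on_same_side (affine hull {reflect_labels V ! i, reflect_labels V ! ((i + 1) mod n)})
              (set V - {reflect_labels V ! i, reflect_labels V ! ((i + 1) mod n)})" if "i < n" for i
  proof -
    let ?j = "n - 1 - i"
    have "n - i = ?j + 1" using that by linarith
    then have "(n - i) mod n = (?j + 1) mod n" by (rule arg_cong)
    moreover have "(n - (i + 1) mod n) mod n = ?j"
    proof (cases "i + 1 = n")
      case False
      then have "i + 1 < n" using that by linarith
      then show ?thesis by simp
    qed auto
    moreover have "(i + 1) mod n < n" using that by simp
    ultimately have "reflect_labels V ! ((i + 1) mod n) = V ! ?j"
      and "reflect_labels V ! i = V ! ((?j + 1) mod n)"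
      using that len nth_reflect_labels[of _ V] by metis+
    then show ?thesis using side[of ?j] that by (simp add: insert_commute)
  qed
  ultimately show ?thesis unfolding convex_ngon_iff using len by simp
qed

section \<open>The two center functions for odd \<open>n\<close>\<close>

lemma angle_commute: "angle A B C = angle C B A"
  by (simp add: angle_def inner_commute mult.commute)

lemma angle_scaleR:
  assumes "t > 0"
  shows "angle (t *\<^sub>R A) (t *\<^sub>R B) (t *\<^sub>R C) = angle A B C"
  using assms by (simp add: angle_def flip: scaleR_diff_right)

text \<open>By the law of cosines the angle depends only on the three mutual distances, so
  \<open>T\<close> need not be known to be affine.\<close>

lemma angle_isometry:
  assumes "\<And>x y. dist (T x) (T y) = dist x y"
  shows "angle (T A) (T B) (T C) = angle A B C"
proof -
  have inner_dist: "(x - z) \<bullet> (y - z) = ((dist x z)\<^sup>2 + (dist y z)\<^sup>2 - (dist x y)\<^sup>2) / 2"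
    for x y z :: "real^2"
    using dot_norm_neg[of "x - z" "y - z"] by (simp add: dist_norm)
  show ?thesis
    unfolding angle_def inner_dist dist_norm[symmetric] by (simp add: assms)
qed

text \<open>For \<open>t = 0\<close> all vertices collapse to the origin. This excludes the
  degenerate case of homogeneity for the angle, where division by zero would give the value
  \<open>arccos 0\<close>.\<close>

lemma ngon_scale_pos:
  assumes "convex_ngon n (map (\<lambda>v. t *\<^sub>R v) V)" "n \<ge> 2" "t \<ge> 0"
  shows "t > 0"
proof (rule ccontr)
  assume "\<not> t > 0"
  then have "t = 0" using assms by simp
  moreover have "length V = n" using assms by (simp add: convex_ngon_def)
  moreover have "map (\<lambda>v. t *\<^sub>R v) V ! 0 \<noteq> map (\<lambda>v. t *\<^sub>R v) V ! 1"
    using assms unfolding convex_ngon_def by (metis One_nat_def less_2_cases_iff order_less_le_trans zero_neq_one)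
  ultimately show False using assms by simp
qed

text \<open>For \<open>n = 2 * m + 1\<close> the positions \<open>m\<close> and \<open>m + 1\<close>
  add up to \<open>n\<close>, so reflecting the labels swaps them and keeps the edge. The degree of
  homogeneity is 1.\<close>

lemma center_function_opposite_side:
  assumes "odd n" "n \<ge> 3"
  shows "center_function {V. convex_ngon n V} (\<lambda>V. dist (V ! (n div 2)) (V ! (n div 2 + 1)))"
proof -
  from \<open>odd n\<close> obtain m where n: "n = 2 * m + 1" by (rule oddE)
  have m: "m \<ge> 1" "n div 2 = m" "m + 1 < n" using assms n by auto
  have "dist (reflect_labels V ! m) (reflect_labels V ! (m + 1)) = dist (V ! m) (V ! (m + 1))"
    if "convex_ngon n V" for V
  proof -
    have "length V = 2 * m + 1" using that n by (simp add: convex_ngon_def)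
    then show ?thesis using m by (simp add: nth_reflect_labels dist_commute)
  qed
  moreover have "dist (map (\<lambda>v. t *\<^sub>R v) V ! m) (map (\<lambda>v. t *\<^sub>R v) V ! (m + 1))
      = t ^ 1 * dist (V ! m) (V ! (m + 1))" if "convex_ngon n V" "t \<ge> 0" for V t
  proof -
    have "length V = n" using that by (simp add: convex_ngon_def)
    then show ?thesis using that m by (simp flip: scaleR_diff_right add: dist_norm)
  qed
  ultimately show ?thesis
    unfolding center_function_def m(2)
    using m by (auto simp: convex_ngon_def intro!: exI[of _ 1])
qed

text \<open>Reflecting the labels fixes position 0 and swaps its neighbours 1 and
  \<open>n - 1\<close>. The degree of homogeneity is 0.\<close>

lemma center_function_angle:
  assumes "n \<ge> 3"
  shows "center_function {V. convex_ngon n V} (\<lambda>V. angle (V ! (n - 1)) (V ! 0) (V ! 1))"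
proof -
  have "angle (reflect_labels V ! (n - 1)) (reflect_labels V ! 0) (reflect_labels V ! 1)
      = angle (V ! (n - 1)) (V ! 0) (V ! 1)" if "convex_ngon n V" for V
  proof -
    have "length V = n" using that by (simp add: convex_ngon_def)
    then show ?thesis using assms by (simp add: nth_reflect_labels angle_commute)
  qed
  moreover have "angle (map (\<lambda>v. t *\<^sub>R v) V ! (n - 1)) (map (\<lambda>v. t *\<^sub>R v) V ! 0) (map (\<lambda>v. t *\<^sub>R v) V ! 1)
      = t ^ 0 * angle (V ! (n - 1)) (V ! 0) (V ! 1)"
    if "convex_ngon n V" "t \<ge> 0" "convex_ngon n (map (\<lambda>v. t *\<^sub>R v) V)" for V t
  proof -
    have "t > 0" using ngon_scale_pos that assms by fastforce
    moreover have "length V = n" using that by (simp add: convex_ngon_def)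
    ultimately show ?thesis using assms by (simp add: angle_scaleR)
  qed
  moreover have "angle (map T V ! (n - 1)) (map T V ! 0) (map T V ! 1)
      = angle (V ! (n - 1)) (V ! 0) (V ! 1)"
    if "convex_ngon n V" "\<forall>x y. dist (T x) (T y) = dist x y" for V T
  proof -
    have "length V = n" using that by (simp add: convex_ngon_def)
    then show ?thesis using assms angle_isometry[of T] that by simp
  qed
  ultimately show ?thesis
    unfolding center_function_def by (intro conjI exI[of _ 0]) blast+
qed

text \<open>Comparison with one fixed edge matches \<open>characterize\<close>, which compares each
  rotation with the unrotated polygon.\<close>

lemma equilateral_iff:
  "equilateral V \<longleftrightarrow>
    (\<forall>i<length V. dist (V ! i) (next_vertex V i) = dist (V ! k) (next_vertex V k))"
  if "k < length V"
  unfolding equilateral_def using that by metis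

lemma equiangular_iff:
  "equiangular V \<longleftrightarrow>
    (\<forall>i<length V. angle (prev_vertex V i) (V ! i) (next_vertex V i) =
      angle (prev_vertex V k) (V ! k) (next_vertex V k))"
  if "k < length V"
  unfolding equiangular_def using that by metis

text \<open>On the rotation by \<open>i\<close> the two functions give the length of edge
  \<open>(i + n div 2) mod n\<close> and the angle at vertex \<open>i\<close>. As \<open>i\<close>
  varies, every edge and every vertex is reached.\<close>

lemma characterize_regular_odd:
  assumes "odd n" "n \<ge> 3"
  shows "characterize {V. convex_ngon n V}
    {\<lambda>V. dist (V ! (n div 2)) (V ! (n div 2 + 1)), \<lambda>V. angle (V ! (n - 1)) (V ! 0) (V ! 1)} regular"
proof -
  let ?m = "n div 2"
  have m: "?m + 1 < n" using assms by (auto elim!: oddE)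
  have "equilateral V \<longleftrightarrow> (\<forall>i<n. dist (rotate i V ! ?m) (rotate i V ! (?m + 1))
            = dist (V ! ?m) (V ! (?m + 1)))" (is "_ \<longleftrightarrow> ?R")
    and "equiangular V \<longleftrightarrow> (\<forall>i<n. angle (rotate i V ! (n - 1)) (rotate i V ! 0) (rotate i V ! 1)
            = angle (V ! (n - 1)) (V ! 0) (V ! 1))"
    if "length V = n" for V
  proof -
    have r: "rotate i V ! ?m = V ! ((i + ?m) mod n)"
      "rotate i V ! (?m + 1) = V ! (((i + ?m) mod n + 1) mod n)" for i
      using that m by (simp_all add: nth_rotate mod_simps)
    have "?R \<longleftrightarrow> (\<forall>i\<in>(\<lambda>i. (i + ?m) mod n) ` {..<n}.
            dist (V ! i) (V ! ((i + 1) mod n)) = dist (V ! ?m) (V ! (?m + 1)))"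
      unfolding r by auto
    \<comment> \<open>A shift permutes the residues; the preimage of \<open>j\<close> is
      \<open>j - ?m\<close>, written as \<open>j + (n - ?m)\<close> to avoid truncated
      subtraction.\<close>
    also have "(\<lambda>i. (i + ?m) mod n) ` {..<n} = {..<n}"
    proof (intro equalityI subsetI)
      fix j assume "j \<in> {..<n}"
      then have "j = ((j + (n - ?m)) mod n + ?m) mod n" using m by (simp add: mod_simps)
      then show "j \<in> (\<lambda>i. (i + ?m) mod n) ` {..<n}"
        by (rule image_eqI) (use m in simp)
    qed (use m in auto)
    also have "(\<forall>i\<in>{..<n}. dist (V ! i) (V ! ((i + 1) mod n)) = dist (V ! ?m) (V ! (?m + 1)))
        \<longleftrightarrow> equilateral V"
      using equilateral_iff[of ?m V] that m by auto
    finally show "equilateral V \<longleftrightarrow> ?R" by simp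
    show "equiangular V \<longleftrightarrow> (\<forall>i<n. angle (rotate i V ! (n - 1)) (rotate i V ! 0) (rotate i V ! 1)
            = angle (V ! (n - 1)) (V ! 0) (V ! 1))"
      using equiangular_iff[of 0 V] that assms by (simp add: nth_rotate)
  qed
  then show ?thesis
    unfolding characterize_def regular_def by (auto simp: convex_ngon_def)
qed

section \<open>Lines, points of the unit circle and reflections\<close>

text \<open>One affine set contains the other, and both have dimension 1 in the plane.\<close>

lemma affine_hull_eq_line:
  fixes a p q :: "real^2"
  assumes "a \<noteq> 0" "p \<noteq> q" "a \<bullet> p = c" "a \<bullet> q = c"
  shows "affine hull {p, q} = {x. a \<bullet> x = c}"
proof (rule affine_dim_equal)
  show "affine hull {p, q} \<subseteq> {x. a \<bullet> x = c}"
    using assms by (intro hull_minimal) (auto simp: affine_hyperplane)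
  show "aff_dim (affine hull {p, q}) = aff_dim {x. a \<bullet> x = c}"
    using assms by (simp add: aff_dim_2 aff_dim_hyperplane)
qed (auto simp: affine_hyperplane)

definition circle_point :: "real \<Rightarrow> real^2" where
  "circle_point x = vector [cos x, sin x]"

lemma circle_point_inner: "circle_point x \<bullet> circle_point y = cos (x - y)"
  by (simp add: circle_point_def inner_vec_def sum_2 cos_diff)

lemma circle_point_nonzero: "circle_point x \<noteq> 0"
  using circle_point_inner[of x x] by auto

lemma circle_point_eq_iff: "circle_point x = circle_point y \<longleftrightarrow> cos (x - y) = 1"
proof
  assume "cos (x - y) = 1"
  then have "(circle_point x - circle_point y) \<bullet> (circle_point x - circle_point y) = 0"
    by (simp add: inner_diff_left inner_diff_right circle_point_inner cos_diff
        mult.commute)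
  then show "circle_point x = circle_point y" by simp
qed (use circle_point_inner[of x x] circle_point_inner[of x y] in auto)

lemma circle_point_add_2pi: "circle_point (x + 2 * pi) = circle_point x"
  by (simp add: circle_point_def)

lemma dist_circle_point: "(dist (circle_point x) (circle_point y))\<^sup>2 = 2 - 2 * cos (x - y)"
  by (simp add: dist_norm power2_norm_eq_inner inner_diff_left inner_diff_right
      circle_point_inner cos_diff)

text \<open>The symmetry of the cosine about \<pi> reduces this to its strict decrease on
  [0, \<pi>]. The case \<open>h = 0\<close> separates points of the circle; a positive
  \<open>h\<close> places points on one side of a chord.\<close>

lemma cos_less_cos_of_between:
  fixes h x :: real
  assumes "0 \<le> h" "h < x" "x < 2 * pi - h"
  shows "cos x < cos h"
proof (cases "x \<le> pi")
  case True
  then show ?thesis using assms by (intro cos_monotone_0_pi) auto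
next
  case False
  have "cos (2 * pi - x) < cos h" using assms False by (intro cos_monotone_0_pi) auto
  then show ?thesis by simp
qed

text \<open>Reflection in the line through the origin at angle \<open>s / 2\<close>. The parameter
  \<open>s\<close> is the sum of any two arguments that it exchanges on the circle.\<close>

definition axis_reflection :: "real \<Rightarrow> real^2 \<Rightarrow> real^2" where
  "axis_reflection s x = (2 * (circle_point (s / 2) \<bullet> x)) *\<^sub>R circle_point (s / 2) - x"

text \<open>The sum-to-product formulas, read coordinatewise.\<close>

lemma axis_reflection_circle_point:
  "axis_reflection s (circle_point x) = circle_point (s - x)"
proof -
  have "cos (s - x) + cos x = 2 * cos (s / 2) * cos (s / 2 - x)"
    "sin (s - x) + sin x = 2 * sin (s / 2) * cos (s / 2 - x)"
    by (simp_all add: cos_plus_cos sin_plus_sin diff_divide_distrib)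
  then show ?thesis
    unfolding axis_reflection_def circle_point_inner
    by (simp add: vec_eq_iff forall_2 circle_point_def algebra_simps)
qed

text \<open>The map is linear and, since the axis vector has length 1, preserves the norm.\<close>

lemma dist_axis_reflection: "dist (axis_reflection s x) (axis_reflection s y) = dist x y"
proof -
  let ?a = "circle_point (s / 2)"
  have "axis_reflection s x - axis_reflection s y = axis_reflection s (x - y)"
    by (simp add: axis_reflection_def inner_diff_right algebra_simps)
  moreover have "axis_reflection s z \<bullet> axis_reflection s z = z \<bullet> z" for z
    by (simp add: axis_reflection_def inner_diff_left inner_diff_right circle_point_inner
        inner_commute algebra_simps)
  ultimately show ?thesis by (simp add: dist_norm norm_eq_sqrt_inner)
qed

section \<open>The inscribed polygon with alternating sides, for even \<open>n\<close>\<close>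

text \<open>
  The central angles between consecutive vertices alternate between \<open>\<pi> / n\<close> and \<open>3\<pi> / n\<close>.
\<close>

definition alt_arg :: "nat \<Rightarrow> nat \<Rightarrow> real" where
  "alt_arg n j = (2 * real j - of_bool (odd j)) * pi / real n"

definition alt_ngon :: "nat \<Rightarrow> ngon" where
  "alt_ngon n = map (\<lambda>j. circle_point (alt_arg n j)) [0..<n]"

context
  fixes n :: nat
  assumes n: "even n" "n \<ge> 4"
begin

text \<open>Each index step adds 2 to the numerator, while the parity correction changes by at most
  1.\<close>

lemma alt_arg_strict_mono: "i < j \<Longrightarrow> alt_arg n i < alt_arg n j"
  unfolding alt_arg_def using n by (auto intro!: divide_strict_right_mono)

text \<open>Since \<open>n\<close> is even, adding it preserves the parity of
  \<open>j\<close>.\<close>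

lemma alt_arg_add_period: "alt_arg n (j + n) = alt_arg n j + 2 * pi"
  unfolding alt_arg_def using n by (simp add: field_simps)


text \<open>The two indices on the left have opposite parity, as have \<open>i\<close> and
  \<open>i + 1\<close>, so one correction occurs on each side. Hence the reflection exchanging
  vertices \<open>i\<close> and \<open>i + 1\<close> exchanges \<open>i - j\<close> and
  \<open>i + 1 + j\<close>; the added \<open>n\<close> avoids truncated subtraction and contributes
  2\<pi>.\<close>

lemma alt_arg_sum:
  assumes "j \<le> n"
  shows "alt_arg n (i + n - j) + alt_arg n (i + 1 + j) = alt_arg n i + alt_arg n (i + 1) + 2 * pi"
proof -
  have "odd (i + n - j) \<longleftrightarrow> even (i + 1 + j)"
    using n assms by (simp add: even_diff_nat)
  then have "of_bool (odd (i + n - j)) + of_bool (odd (i + 1 + j)) = (1::real)"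
    by simp
  then show ?thesis
    unfolding alt_arg_def add_divide_distrib[symmetric]
    using n assms by (simp add: field_simps of_nat_diff)
qed

text \<open>Periodicity allows vertex indices beyond \<open>n\<close>, where the arguments keep
  increasing instead of wrapping around.\<close>

lemma circle_point_alt_arg_mod: "circle_point (alt_arg n (j mod n)) = circle_point (alt_arg n j)"
proof (induction j rule: less_induct)
  case (less j)
  show ?case
  proof (cases "j < n")
    case False
    then have "j = (j - n) + n" by simp
    then have "circle_point (alt_arg n j) = circle_point (alt_arg n (j - n))"
      by (metis alt_arg_add_period circle_point_add_2pi)
    moreover have "j mod n = (j - n) mod n" using False by (simp add: le_mod_geq)
    moreover have "j - n < j" using False n by simp
    ultimately show ?thesis using less[of "j - n"] by simp
  qed simp
qed

lemma nth_alt_ngon_mod: "alt_ngon n ! (j mod n) = circle_point (alt_arg n j)"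
  using n by (simp add: alt_ngon_def circle_point_alt_arg_mod)

lemma length_alt_ngon: "length (alt_ngon n) = n"
  by (simp add: alt_ngon_def)

lemma circle_point_alt_arg_neq:
  assumes "i < j" "j < i + n"
  shows "circle_point (alt_arg n i) \<noteq> circle_point (alt_arg n j)"
proof -
  have "alt_arg n i < alt_arg n j" "alt_arg n j < alt_arg n i + 2 * pi"
    using alt_arg_strict_mono assms alt_arg_add_period by metis+
  then have "cos (alt_arg n j - alt_arg n i) < cos 0"
    by (intro cos_less_cos_of_between) auto
  then show ?thesis by (metis circle_point_eq_iff cos_zero less_irrefl)
qed

text \<open>The line through the points at consecutive arguments \<alpha> and \<beta> has as normal
  the unit vector at their mean, with offset \<open>cos h\<close> for half the central angle
  \<open>h\<close>. All other vertices have arguments strictly between \<beta> and \<alpha> +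
  2\<pi>, at angular distance more than \<open>h\<close> from the mean.\<close>

lemma convex_alt_ngon: "convex_ngon n (alt_ngon n)"
proof -
  have dis: "alt_ngon n ! i \<noteq> alt_ngon n ! j" if "i < j" "j < n" for i j
    using that circle_point_alt_arg_neq[of i j] by (simp add: alt_ngon_def)
  have side: "on_same_side (affine hull {alt_ngon n ! i, alt_ngon n ! ((i + 1) mod n)})
              {alt_ngon n ! j |j. j < n \<and> j \<noteq> i \<and> j \<noteq> (i + 1) mod n}" if i: "i < n" for i
  proof -
    define \<alpha> \<beta> where "\<alpha> = alt_arg n i" and "\<beta> = alt_arg n (i + 1)"
    define a where "a = circle_point ((\<alpha> + \<beta>) / 2)"
    define h where "h = (\<beta> - \<alpha>) / 2"
    have h: "0 \<le> h" using alt_arg_strict_mono[of i "i + 1"] by (simp add: h_def \<alpha>_def \<beta>_def)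
    have V: "alt_ngon n ! i = circle_point \<alpha>" "alt_ngon n ! ((i + 1) mod n) = circle_point \<beta>"
      using i nth_alt_ngon_mod[of i] nth_alt_ngon_mod[of "i + 1"] by (simp_all add: \<alpha>_def \<beta>_def)
    have "(\<alpha> + \<beta>) / 2 - \<alpha> = h" "(\<alpha> + \<beta>) / 2 - \<beta> = - h" by (simp_all add: h_def field_simps)
    then have "a \<bullet> circle_point \<alpha> = cos h" "a \<bullet> circle_point \<beta> = cos h"
      unfolding a_def circle_point_inner by (simp_all only: cos_minus)
    moreover have "circle_point \<alpha> \<noteq> circle_point \<beta>"
      using circle_point_alt_arg_neq[of i "i + 1"] n by (simp add: \<alpha>_def \<beta>_def)
    moreover have "a \<noteq> 0" by (simp add: a_def circle_point_nonzero)
    ultimately have line: "affine hull {circle_point \<alpha>, circle_point \<beta>} = {x. a \<bullet> x = cos h}"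
      by (intro affine_hull_eq_line)
    have "a \<bullet> alt_ngon n ! j < cos h" if j: "j < n" "j \<noteq> i" "j \<noteq> (i + 1) mod n" for j
    proof -
      \<comment> \<open>\<open>k\<close> is the representative of \<open>j\<close> modulo
        \<open>n\<close> that lies strictly between \<open>i + 1\<close> and
        \<open>i + n\<close>.\<close>
      define k where "k = (if j < i then j + n else j)"
      have "k mod n = j" using j by (simp add: k_def)
      moreover have "i + 1 < k \<and> k < i + n"
      \<comment> \<open>On the closing edge the second endpoint is position 0, so \<open>j\<close>
        is positive and \<open>k = j + n\<close> exceeds \<open>i + 1 = n\<close>.\<close>
      proof (cases "i + 1 = n")
        case True
        then show ?thesis using i j by (auto simp: k_def)
      next
        case False
        then have "i + 1 < n" using i by simp
        then show ?thesis using j by (auto simp: k_def)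
      qed
      ultimately have k: "i + 1 < k" "k < i + n" "k mod n = j" by auto
      have "\<beta> < alt_arg n k" "alt_arg n k < \<alpha> + 2 * pi"
        using alt_arg_strict_mono k alt_arg_add_period unfolding \<alpha>_def \<beta>_def by metis+
      then have "cos (alt_arg n k - (\<alpha> + \<beta>) / 2) < cos h"
        using h by (intro cos_less_cos_of_between) (auto simp: h_def field_simps)
      moreover have "a \<bullet> alt_ngon n ! j = cos (alt_arg n k - (\<alpha> + \<beta>) / 2)"
        using nth_alt_ngon_mod[of k] k by (simp add: a_def inner_commute flip: circle_point_inner)
      ultimately show ?thesis by simp
    qed
    then show ?thesis
      unfolding on_same_side_def V line using \<open>a \<noteq> 0\<close> by blast
  qed
  have neq: "alt_ngon n ! i \<noteq> alt_ngon n ! j" if "i < n" "j < n" "i \<noteq> j" for i j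
    using dis[of i j] dis[of j i] that by (cases "i < j") auto
  then show ?thesis
    unfolding convex_ngon_def length_alt_ngon by (intro conjI allI impI refl neq side)
qed

text \<open>The first two edges subtend \<pi>/n and 3\<pi>/n. Both angles lie in [0, \<pi>] because
  \<open>n \<ge> 4\<close>, so their cosines, and hence the chords, differ.\<close>

lemma not_equilateral_alt_ngon: "\<not> equilateral (alt_ngon n)"
proof
  assume "equilateral (alt_ngon n)"
  then have "dist (alt_ngon n ! 0) (alt_ngon n ! 1) = dist (alt_ngon n ! 1) (alt_ngon n ! 2)"
    using n equilateral_iff[of 0 "alt_ngon n"] unfolding length_alt_ngon
    by (auto dest!: spec[of _ 1] simp: numeral_2_eq_2)
  then have "(dist (alt_ngon n ! 1) (alt_ngon n ! 0))\<^sup>2 = (dist (alt_ngon n ! 2) (alt_ngon n ! 1))\<^sup>2"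
    by (simp add: dist_commute)
  moreover have "alt_ngon n ! j = circle_point (alt_arg n j)" if "j \<le> 2" for j
    using that n by (simp add: alt_ngon_def)
  ultimately have "cos (alt_arg n 1 - alt_arg n 0) = cos (alt_arg n 2 - alt_arg n 1)"
    by (simp add: dist_circle_point)
  moreover have "alt_arg n 1 - alt_arg n 0 = pi / n" "alt_arg n 2 - alt_arg n 1 = 3 * pi / n"
    by (simp_all add: alt_arg_def field_simps)
  moreover have "cos (3 * pi / n) < cos (pi / n)"
    using n by (intro cos_monotone_0_pi) (auto simp: field_simps)
  ultimately show False by simp
qed

text \<open>The axis is the perpendicular bisector of edge \<open>i\<close>. Vertex
  \<open>i + j\<close> goes to vertex \<open>i + 1 - j\<close>, which is position \<open>j\<close>
  when counting backwards from \<open>i + 1\<close>.\<close>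

lemma axis_reflection_alt_ngon:
  "map (axis_reflection (alt_arg n i + alt_arg n (i + 1))) (rotate i (alt_ngon n))
     = reflect_labels (rotate (i + 1) (alt_ngon n))"
proof (rule nth_equalityI)
  fix j assume "j < length (map (axis_reflection (alt_arg n i + alt_arg n (i + 1))) (rotate i (alt_ngon n)))"
  then have j: "j < n" by (simp add: length_alt_ngon)
  let ?s = "alt_arg n i + alt_arg n (i + 1)"
  have "map (axis_reflection ?s) (rotate i (alt_ngon n)) ! j = circle_point (?s - alt_arg n (i + j))"
    using j by (simp add: length_alt_ngon nth_rotate nth_alt_ngon_mod axis_reflection_circle_point)
  moreover have "reflect_labels (rotate (i + 1) (alt_ngon n)) ! j
      = alt_ngon n ! ((i + 1 + (n - j) mod n) mod n)"
    using j nth_rotate[of "(n - j) mod n" "alt_ngon n" "i + 1"]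
    by (simp add: length_alt_ngon nth_reflect_labels)
  moreover have "\<dots> = circle_point (alt_arg n (i + 1 + (n - j)))"
    by (metis mod_add_right_eq nth_alt_ngon_mod)
  moreover have "alt_arg n (i + 1 + (n - j)) = ?s - alt_arg n (i + j) + 2 * pi"
    using alt_arg_sum[of "n - j" i] j by (simp add: algebra_simps)
  ultimately show "map (axis_reflection ?s) (rotate i (alt_ngon n)) ! j
      = reflect_labels (rotate (i + 1) (alt_ngon n)) ! j"
    by (simp add: circle_point_add_2pi)
qed (simp add: length_alt_ngon)

text \<open>Invariance under the isometry and then under the reflection of labels passes from
  rotation \<open>i\<close> to rotation \<open>i + 1\<close>. Both apply only within the domain, so
  every intermediate polygon has to be convex.\<close>

lemma center_function_rotate_alt_ngon:
  assumes f: "center_function {V. convex_ngon n V} f"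
  shows "f (rotate i (alt_ngon n)) = f (alt_ngon n)"
proof (induction i)
  case (Suc i)
  let ?T = "axis_reflection (alt_arg n i + alt_arg n (i + 1))"
  let ?W = "rotate (i + 1) (alt_ngon n)"
  have conv: "convex_ngon n (rotate k (alt_ngon n))" for k
    by (intro convex_ngon_rotate convex_alt_ngon)
  have reflected: "map ?T (rotate i (alt_ngon n)) = reflect_labels ?W"
    by (rule axis_reflection_alt_ngon)
  have "convex_ngon n (reflect_labels ?W)"
    by (intro convex_ngon_reflect_labels conv)
  then have "f (reflect_labels ?W) = f ?W"
    and "f (map ?T (rotate i (alt_ngon n))) = f (rotate i (alt_ngon n))"
    using conv reflected
    by (intro center_function_reflect_labels[OF f] center_function_isometry[OF f];
        simp only: mem_Collect_eq dist_axis_reflection)+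
  then show ?case using Suc reflected by simp
qed simp

text \<open>The alternating polygon satisfies all the equalities without being regular, whatever the
  number of functions in \<open>Fs\<close>.\<close>

lemma not_characterize_regular_even:
  assumes "\<And>f. f \<in> Fs \<Longrightarrow> center_function {V. convex_ngon n V} f"
  shows "\<not> characterize {V. convex_ngon n V} Fs regular"
  using assms convex_alt_ngon not_equilateral_alt_ngon center_function_rotate_alt_ngon
  unfolding characterize_def regular_def by blast

end

theorem corollary21:
  shows "(\<forall>n\<ge>3. odd n \<longrightarrow>
            (\<exists>f1 f2. center_function {V. convex_ngon n V} f1 \<and>
                     center_function {V. convex_ngon n V} f2 \<and>
                     characterize {V. convex_ngon n V} {f1, f2} regular)) \<and>
         (\<forall>n\<ge>4. even n \<longrightarrow>
            \<not> (\<exists>f1 f2. center_function {V. convex_ngon n V} f1 \<and>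
                       center_function {V. convex_ngon n V} f2 \<and>
                       characterize {V. convex_ngon n V} {f1, f2} regular))"
proof (intro conjI allI impI)
  fix n :: nat
  assume "n \<ge> 3" "odd n"
  then show "\<exists>f1 f2. center_function {V. convex_ngon n V} f1 \<and>
                     center_function {V. convex_ngon n V} f2 \<and>
                     characterize {V. convex_ngon n V} {f1, f2} regular"
    \<comment> \<open>The witnesses are the opposite side for \<open>f1\<close> and the angle for
      \<open>f2\<close>.\<close>
    by (intro exI conjI)
      (rule center_function_opposite_side center_function_angle characterize_regular_odd; assumption)+
next
  fix n :: nat
  assume "n \<ge> 4" "even n"
  then show "\<not> (\<exists>f1 f2. center_function {V. convex_ngon n V} f1 \<and>
                       center_function {V. convex_ngon n V} f2 \<and>
                       characterize {V. convex_ngon n V} {f1, f2} regular)"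
    using not_characterize_regular_even[of n "{f1, f2}" for f1 f2] by (metis insertE singletonD)
qed

end
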